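(* Let $Y \in L^2(\Omega;\mathbb{R})$ and let $(Y_n)_{n \in \mathbb{N}_0} \subset L^2(\Omega;\mathbb{R})$ be such that $\lim_{n\to\infty} |\mathbb{E}[Y-Y_n]| = 0$. Then for all $n \in \mathbb{N}_0$ and $N \in \mathbb{N}$, the sampling error of approximating $|\mathbb{E}[Y-Y_n]|$ by $|E_N[Y-Y_n]|$ is bounded from below by \[ \big\| |\mathbb{E}[Y - Y_n]| - |E_N[Y-Y_n]| \big\|_{L^2(\Omega;\mathbb{R})} \ge -|\mathbb{E}[Y-Y_n]| + \left(|\mathbb{E}[Y-Y_n]|^2 + N^{-1} \mathrm{Var}[Y-Y_n]\right)^{1/2} \] and from above by \[ \big\| |\mathbb{E}[Y - Y_n]| - |E_N[Y-Y_n]| \big\|_{L^2(\Omega;\mathbb{R})} \le N^{-1/2} (\mathrm{Var}[Y-Y_n])^{1/2}. \]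
   Context: $(\Omega,\mathcal{A},P)$ is a probability space. $L^2(\Omega;\mathbb{R})$ is the space of real-valued random variables $Z$ with $\|Z\|_{L^2(\Omega;\mathbb{R})}^2 = \mathbb{E}[|Z|^2] < \infty$. For a real-valued random variable $Z$ and $N \in \mathbb{N}$, the Monte Carlo estimator is $E_N[Z] = N^{-1}\sum_{i=1}^N Z^{(i)}$, where $(Z^{(i)})_{i=1}^N$ is a sequence of independent, identically distributed random variables on $\Omega$ with the same law as $Z$. In particular, $E_N[Y-Y_n]$ averages $N$ i.i.d. copies of the difference $Y-Y_n$. *)

theory Defs
  imports "HOL-Probability.Probability"
begin

text \<open>
  Elements of \<open>L\<^sup>2(\<Omega>;\<real>)\<close> are represented by measurable functions, not by classes modulo
  almost sure equality.
\<close>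

definition L2_rv :: "'a measure \<Rightarrow> ('a \<Rightarrow> real) set" where
  "L2_rv M = {Z \<in> borel_measurable M. integrable M (\<lambda>\<omega>. \<bar>Z \<omega>\<bar>\<^sup>2)}"

text \<open>
  Meaningful only on \<open>L2_rv M\<close>: the Bochner integral of a non-integrable function is 0.
\<close>

definition norm_L2 :: "'a measure \<Rightarrow> ('a \<Rightarrow> real) \<Rightarrow> real" where
  "norm_L2 M Z = sqrt (prob_space.expectation M (\<lambda>\<omega>. \<bar>Z \<omega>\<bar>\<^sup>2))"

definition iid_copies ::
  "'a measure \<Rightarrow> nat \<Rightarrow> ('a \<Rightarrow> real) \<Rightarrow> (nat \<Rightarrow> 'a \<Rightarrow> real) \<Rightarrow> bool" where
  "iid_copies M N Z Zs \<longleftrightarrow>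
     prob_space.indep_vars M (\<lambda>_. borel) Zs {1..N} \<and>
     (\<forall>i\<in>{1..N}. distr M borel (Zs i) = distr M borel Z)"

text \<open>
  The estimator \<open>E\<^sub>N[Z]\<close> is a function of the chosen copies \<open>Zs\<close> of \<open>Z\<close>, not of \<open>Z\<close> alone.
\<close>

definition MC_estimator :: "nat \<Rightarrow> (nat \<Rightarrow> 'a \<Rightarrow> real) \<Rightarrow> 'a \<Rightarrow> real" where
  "MC_estimator N Zs \<omega> = inverse (real N) * (\<Sum>i=1..N. Zs i \<omega>)"

end

theory Submission
  imports Defs
begin

text \<open>
  Let \<open>S\<close> be the estimator, \<open>e = \<bbbE>[S]\<close> and \<open>s\<^sup>2 = \<bbbE>[S\<^sup>2]\<close>; independence of the copies gives
  \<open>s\<^sup>2 = e\<^sup>2 + V/N\<close>. The squared error is \<open>e\<^sup>2 - 2 \<bar>e\<bar> \<bbbE>\<bar>S\<bar> + s\<^sup>2\<close>, and both bounds come from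
  \<open>\<bar>e\<bar> \<le> \<bbbE>\<bar>S\<bar> \<le> s\<close>: the left inequality turns it into at most \<open>V/N\<close>, the right one into at
  least \<open>(s - \<bar>e\<bar>)\<^sup>2\<close>.
\<close>

lemma integrable_square_add:
  fixes X Y :: "'a \<Rightarrow> real"
  assumes [measurable]: "X \<in> borel_measurable M" "Y \<in> borel_measurable M"
    and "integrable M (\<lambda>\<omega>. (X \<omega>)\<^sup>2)" "integrable M (\<lambda>\<omega>. (Y \<omega>)\<^sup>2)"
  shows "integrable M (\<lambda>\<omega>. (X \<omega> + Y \<omega>)\<^sup>2)"
proof (rule Bochner_Integration.integrable_bound)
  show "integrable M (\<lambda>\<omega>. 2 * (X \<omega>)\<^sup>2 + 2 * (Y \<omega>)\<^sup>2)"
    using assms by auto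
  \<comment> \<open>The parallelogram identity: the two sides differ by
    \<open>(x - y)\<^sup>2\<close>.\<close>
  have "(x + y)\<^sup>2 \<le> 2 * x\<^sup>2 + 2 * y\<^sup>2" for x y :: real
    using zero_le_power2[of "x - y"] by (simp add: power2_sum power2_diff)
  then show "AE \<omega> in M. norm ((X \<omega> + Y \<omega>)\<^sup>2) \<le> norm (2 * (X \<omega>)\<^sup>2 + 2 * (Y \<omega>)\<^sup>2)"
    by auto
qed measurable

context prob_space
begin

text \<open>Independence factors \<open>\<bbbE>[X Y]\<close>, so twice this mixed term cancels
  against the cross term of the squared mean.\<close>

lemma variance_add_indep:
  fixes X Y :: "'a \<Rightarrow> real"
  assumes ind: "indep_var borel X borel Y"
    and sqX: "integrable M (\<lambda>\<omega>. (X \<omega>)\<^sup>2)" and sqY: "integrable M (\<lambda>\<omega>. (Y \<omega>)\<^sup>2)"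
  shows "variance (\<lambda>\<omega>. X \<omega> + Y \<omega>) = variance X + variance Y"
proof -
  have m: "X \<in> borel_measurable M" "Y \<in> borel_measurable M"
    using indep_var_rv1[OF ind] indep_var_rv2[OF ind] by auto
  have iX: "integrable M X" and iY: "integrable M Y"
    using square_integrable_imp_integrable m sqX sqY by blast+
  note XY = indep_var_integrable[OF ind iX iY] indep_var_lebesgue_integral[OF ind iX iY]
  have "expectation (\<lambda>\<omega>. (X \<omega> + Y \<omega>)\<^sup>2) =
      expectation (\<lambda>\<omega>. (X \<omega>)\<^sup>2 + (Y \<omega>)\<^sup>2 + 2 * (X \<omega> * Y \<omega>))"
    by (simp add: power2_sum mult.assoc)
  also have "\<dots> = expectation (\<lambda>\<omega>. (X \<omega>)\<^sup>2) + expectation (\<lambda>\<omega>. (Y \<omega>)\<^sup>2)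
      + 2 * (expectation X * expectation Y)"
    using sqX sqY XY by simp
  finally show ?thesis
    using iX iY variance_eq[OF iX sqX] variance_eq[OF iY sqY]
      variance_eq[OF Bochner_Integration.integrable_add[OF iX iY] integrable_square_add[OF m sqX sqY]]
    by (simp add: power2_sum)
qed

text \<open>Both claims go through a single induction: splitting off one summand from the variance
  uses that the remaining sum is square integrable.\<close>

lemma variance_sum_indep:
  fixes X :: "'i \<Rightarrow> 'a \<Rightarrow> real"
  assumes "finite I" "indep_vars (\<lambda>_. borel) X I"
    and "\<And>i. i \<in> I \<Longrightarrow> integrable M (\<lambda>\<omega>. (X i \<omega>)\<^sup>2)"
  shows "integrable M (\<lambda>\<omega>. (\<Sum>i\<in>I. X i \<omega>)\<^sup>2)"
    and "variance (\<lambda>\<omega>. \<Sum>i\<in>I. X i \<omega>) = (\<Sum>i\<in>I. variance (X i))"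
proof -
  have "integrable M (\<lambda>\<omega>. (\<Sum>i\<in>I. X i \<omega>)\<^sup>2) \<and>
      variance (\<lambda>\<omega>. \<Sum>i\<in>I. X i \<omega>) = (\<Sum>i\<in>I. variance (X i))"
    using assms
  proof (induction I rule: finite_induct)
    case empty
    show ?case by simp
  next
    case (insert j I)
    have ind: "indep_var borel (X j) borel (\<lambda>\<omega>. \<Sum>i\<in>I. X i \<omega>)"
      using insert by (intro indep_vars_sum) auto
    have "indep_vars (\<lambda>_. borel) X I"
      using insert.prems(1) by (rule indep_vars_subset) auto
    then have IH: "integrable M (\<lambda>\<omega>. (\<Sum>i\<in>I. X i \<omega>)\<^sup>2)"
      "variance (\<lambda>\<omega>. \<Sum>i\<in>I. X i \<omega>) = (\<Sum>i\<in>I. variance (X i))"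
      using insert by auto
    have "integrable M (\<lambda>\<omega>. (X j \<omega>)\<^sup>2)"
      using insert.prems by simp
    then show ?case
      using integrable_square_add[OF indep_var_rv1[OF ind] indep_var_rv2[OF ind]]
        variance_add_indep[OF ind] IH insert.hyps by simp
  qed
  then show "integrable M (\<lambda>\<omega>. (\<Sum>i\<in>I. X i \<omega>)\<^sup>2)"
    "variance (\<lambda>\<omega>. \<Sum>i\<in>I. X i \<omega>) = (\<Sum>i\<in>I. variance (X i))"
    by auto
qed

lemma MC_estimator_moments:
  assumes Z: "Z \<in> L2_rv M" and N: "N \<ge> 1" and iid: "iid_copies M N Z Zs"
  shows "MC_estimator N Zs \<in> L2_rv M"
    and "expectation (MC_estimator N Zs) = expectation Z"
    and "variance (MC_estimator N Zs) = inverse (real N) * variance Z"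
proof -
  let ?S = "\<lambda>\<omega>. \<Sum>i=1..N. Zs i \<omega>"
  have MC: "MC_estimator N Zs = (\<lambda>\<omega>. inverse (real N) * ?S \<omega>)"
    by (auto simp: MC_estimator_def)
  have mZ [measurable]: "Z \<in> borel_measurable M" and sqZ: "integrable M (\<lambda>\<omega>. (Z \<omega>)\<^sup>2)"
    using Z by (auto simp: L2_rv_def)
  have ind: "indep_vars (\<lambda>_. borel) Zs {1..N}"
    and d: "\<And>i. i \<in> {1..N} \<Longrightarrow> distr M borel (Zs i) = distr M borel Z"
    using iid by (auto simp: iid_copies_def)
  have m: "Zs i \<in> borel_measurable M" if "i \<in> {1..N}" for i
    using ind that by (auto simp: indep_vars_def)
  \<comment> \<open>Equal laws transfer every Borel function \<open>g\<close> of a copy to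
    \<open>Z\<close>. Below, \<open>g\<close> is the square, the identity and the square centred at
    \<open>expectation Z\<close>.\<close>
  have int: "integrable M (\<lambda>\<omega>. g (Zs i \<omega>)) \<longleftrightarrow> integrable M (\<lambda>\<omega>. g (Z \<omega>))"
    and exp: "expectation (\<lambda>\<omega>. g (Zs i \<omega>)) = expectation (\<lambda>\<omega>. g (Z \<omega>))"
    if i: "i \<in> {1..N}" and g: "g \<in> borel_measurable borel" for i and g :: "real \<Rightarrow> real"
    using integrable_distr_eq[OF m[OF i] g] integrable_distr_eq[OF mZ g]
      integral_distr[OF m[OF i] g] integral_distr[OF mZ g] d[OF i] by simp_all
  have sq: "integrable M (\<lambda>\<omega>. (Zs i \<omega>)\<^sup>2)" if "i \<in> {1..N}" for i
    using int[OF that, of "\<lambda>x. x\<^sup>2"] sqZ by simp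
  have i1: "integrable M (Zs i)" if "i \<in> {1..N}" for i
    using square_integrable_imp_integrable[OF m[OF that] sq[OF that]] .
  have ex: "expectation (Zs i) = expectation Z" if "i \<in> {1..N}" for i
    using exp[OF that, of "\<lambda>x. x"] by simp
  \<comment> \<open>The means agree by \<open>ex\<close>, so both variances are expectations of the
    same centred square.\<close>
  have var: "variance (Zs i) = variance Z" if "i \<in> {1..N}" for i
    using exp[OF that, of "\<lambda>x. (x - expectation Z)\<^sup>2"] ex[OF that] by simp
  have mS: "?S \<in> borel_measurable M"
    using m by (intro borel_measurable_sum) auto
  have S: "integrable M (\<lambda>\<omega>. (?S \<omega>)\<^sup>2)" "variance ?S = (\<Sum>i=1..N. variance (Zs i))"
    using variance_sum_indep[OF _ ind sq] by auto
  show "MC_estimator N Zs \<in> L2_rv M"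
    using S(1) mS by (auto simp: MC L2_rv_def power_mult_distrib)
  have "expectation ?S = real N * expectation Z"
    using i1 ex by simp
  then show "expectation (MC_estimator N Zs) = expectation Z"
    using N by (simp add: MC)
  \<comment> \<open>The factor leaves the variance squared; one power of it is then absorbed by the
    \<open>N\<close> equal summands of \<open>variance ?S\<close>.\<close>
  have "variance (MC_estimator N Zs) = (inverse (real N))\<^sup>2 * variance ?S"
    unfolding MC by (simp add: right_diff_distrib[symmetric] power_mult_distrib del: power_inverse)
  also have "variance ?S = real N * variance Z"
    unfolding S(2) using var by simp
  finally show "variance (MC_estimator N Zs) = inverse (real N) * variance Z"
    using N by (simp add: power2_eq_square)
qed

text \<open>Stated for an arbitrary square-integrable \<open>S\<close>: the sampling structure of
  the estimator enters only afterwards, through its mean and variance.\<close>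

lemma norm_L2_abs_error_bounds:
  fixes S :: "'a \<Rightarrow> real"
  assumes "S \<in> L2_rv M"
  defines "err \<equiv> (\<lambda>\<omega>. \<bar>expectation S\<bar> - \<bar>S \<omega>\<bar>)"
  shows "err \<in> L2_rv M"
    and "- \<bar>expectation S\<bar> + sqrt (\<bar>expectation S\<bar>\<^sup>2 + variance S) \<le> norm_L2 M err"
    and "norm_L2 M err \<le> sqrt (variance S)"
proof -
  define e where "e = expectation S"
  define a where "a = expectation (\<lambda>\<omega>. \<bar>S \<omega>\<bar>)"
  have m [measurable]: "S \<in> borel_measurable M" and sq: "integrable M (\<lambda>\<omega>. (S \<omega>)\<^sup>2)"
    using assms(1) by (auto simp: L2_rv_def)
  have i: "integrable M S"
    using square_integrable_imp_integrable[OF m sq] .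
  have s: "expectation (\<lambda>\<omega>. (S \<omega>)\<^sup>2) = e\<^sup>2 + variance S"
    using variance_eq[OF i sq] by (simp add: e_def)
  have err_sq: "\<bar>err \<omega>\<bar>\<^sup>2 = e\<^sup>2 + (S \<omega>)\<^sup>2 - 2 * \<bar>e\<bar> * \<bar>S \<omega>\<bar>" for \<omega>
    by (simp add: err_def e_def power2_diff)
  have "err \<in> borel_measurable M"
    unfolding err_def by measurable
  moreover have "integrable M (\<lambda>\<omega>. \<bar>err \<omega>\<bar>\<^sup>2)"
    unfolding err_sq using i sq by simp
  ultimately show "err \<in> L2_rv M"
    unfolding L2_rv_def by blast
  \<comment> \<open>Beyond the mean and variance of \<open>S\<close>, only \<open>a\<close> occurs
    here, so the two bounds reduce to bounding \<open>a\<close> from either side.\<close>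
  have E: "expectation (\<lambda>\<omega>. \<bar>err \<omega>\<bar>\<^sup>2) = 2 * e\<^sup>2 + variance S - 2 * \<bar>e\<bar> * a"
    unfolding err_sq using i sq s by (simp add: a_def prob_space)
  have "\<bar>e\<bar> \<le> a"
    using integral_abs_bound[of M S] by (simp add: e_def a_def)
  then have "\<bar>e\<bar> * \<bar>e\<bar> \<le> \<bar>e\<bar> * a"
    by (intro mult_left_mono) auto
  then show "norm_L2 M err \<le> sqrt (variance S)"
    unfolding norm_L2_def E by (simp add: power2_eq_square)
  define t where "t = sqrt (e\<^sup>2 + variance S)"
  \<comment> \<open>This is the nonnegativity of the variance of \<open>\<bar>S\<bar>\<close>, whose
    second moment is that of \<open>S\<close>.\<close>
  have "a\<^sup>2 \<le> e\<^sup>2 + variance S"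
    using variance_positive[of "\<lambda>\<omega>. \<bar>S \<omega>\<bar>"] variance_eq[of "\<lambda>\<omega>. \<bar>S \<omega>\<bar>"] i sq s
    by (simp add: a_def)
  then have "a \<le> t"
    unfolding t_def by (rule real_le_rsqrt)
  then have "\<bar>e\<bar> * a \<le> \<bar>e\<bar> * t"
    by (intro mult_left_mono) auto
  moreover have "t\<^sup>2 = e\<^sup>2 + variance S"
    unfolding t_def by (rule real_sqrt_pow2) (simp add: variance_positive)
  \<comment> \<open>Since \<open>a\<close> enters \<open>E\<close> with a negative sign, replacing
    it by the larger \<open>t\<close> lowers the value and completes the square.\<close>
  ultimately have "(t - \<bar>e\<bar>)\<^sup>2 \<le> expectation (\<lambda>\<omega>. \<bar>err \<omega>\<bar>\<^sup>2)"
    unfolding E by (simp add: power2_diff mult.commute)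
  then have "t - \<bar>e\<bar> \<le> norm_L2 M err"
    unfolding norm_L2_def by (rule real_le_rsqrt)
  then show "- \<bar>expectation S\<bar> + sqrt (\<bar>expectation S\<bar>\<^sup>2 + variance S) \<le> norm_L2 M err"
    by (simp add: t_def e_def)
qed

end

text \<open>The copies \<open>Zs\<close> are arbitrary. Membership of \<open>err\<close> in
  \<open>L2_rv M\<close> ensures that \<open>norm_L2 M err\<close> is a true norm and not the
  default value of a divergent integral.\<close>

theorem proposition2p3:
  fixes M :: "'a measure"
    and Y :: "'a \<Rightarrow> real"
    and Yn :: "nat \<Rightarrow> 'a \<Rightarrow> real"
  assumes "prob_space M"
    and "Y \<in> L2_rv M"
    and "\<And>n. Yn n \<in> L2_rv M"
    and "(\<lambda>n. \<bar>prob_space.expectation M (\<lambda>\<omega>. Y \<omega> - Yn n \<omega>)\<bar>) \<longlonglongrightarrow> 0"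
  shows "\<forall>n N Zs. N \<ge> 1 \<longrightarrow> iid_copies M N (\<lambda>\<omega>. Y \<omega> - Yn n \<omega>) Zs \<longrightarrow>
    (let e = prob_space.expectation M (\<lambda>\<omega>. Y \<omega> - Yn n \<omega>);
         V = prob_space.variance M (\<lambda>\<omega>. Y \<omega> - Yn n \<omega>);
         err = (\<lambda>\<omega>. \<bar>e\<bar> - \<bar>MC_estimator N Zs \<omega>\<bar>)
     in err \<in> L2_rv M \<and>
        norm_L2 M err \<ge> - \<bar>e\<bar> + sqrt (\<bar>e\<bar>\<^sup>2 + inverse (real N) * V) \<and>
        norm_L2 M err \<le> inverse (sqrt (real N)) * sqrt V)"
proof (intro allI impI)
  interpret prob_space M by fact
  fix n N :: nat and Zs
  let ?Z = "\<lambda>\<omega>. Y \<omega> - Yn n \<omega>"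
  assume N: "N \<ge> 1" and iid: "iid_copies M N ?Z Zs"
  have "?Z \<in> L2_rv M"
    using integrable_square_add[of Y M "\<lambda>\<omega>. - Yn n \<omega>"] assms(2) assms(3)[of n]
    by (auto simp: L2_rv_def)
  note mom = MC_estimator_moments[OF this N iid]
  show "let e = expectation ?Z; V = variance ?Z; err = (\<lambda>\<omega>. \<bar>e\<bar> - \<bar>MC_estimator N Zs \<omega>\<bar>)
     in err \<in> L2_rv M \<and>
        norm_L2 M err \<ge> - \<bar>e\<bar> + sqrt (\<bar>e\<bar>\<^sup>2 + inverse (real N) * V) \<and>
        norm_L2 M err \<le> inverse (sqrt (real N)) * sqrt V"
    \<comment> \<open>The order matters: the variance in \<open>mom(3)\<close> contains the mean of
      the estimator, so rewriting with \<open>mom(2)\<close> first would destroy the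
      pattern.\<close>
    using norm_L2_abs_error_bounds[OF mom(1), unfolded mom(3), unfolded mom(2)]
    by (simp only: Let_def real_sqrt_mult real_sqrt_inverse simp_thms)
qed

end
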